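(* Let $1<\sigma<2$, $0<T<\infty$, $b\in\mathbb{R}$ with $b\neq 0$, and let $f:(0,T]\times\mathbb{R}\times\mathbb{R}\to\mathbb{R}$ be such that $f$ is continuous on $(0,T]\times\mathbb{R}\times\mathbb{R}$, and $(x,t_1,t_2)\mapsto x^{\sigma-1}f(x,t_1,t_2)$ is (i.e. extends to) a continuous function on $[0,T]\times\mathbb{R}\times\mathbb{R}$. Let $T_0\in(0,T]$ be the existence time defined in the context (associated with constants $r,\mathcal{M}>0$ as described there). Assume that there exists a positive real number $L\leq \frac{2-\sigma}{T(1+\Gamma(3-\sigma))}$ such that $$x^{\sigma-1}\left|f(x,t_{1,1},t_{2,1})-f(x,t_{1,2},t_{2,2})\right|\leq L\left(\left|t_{1,1}-t_{1,2}\right|+\left|t_{2,1}-t_{2,2}\right|\right)$$ for all $x\in[0,T]$ and all $t_{1,i},t_{2,i}\in\mathbb{R}$, $i=1,2$. Then the initial value problem $$D^{\sigma}\omega(x)=f\big(x,\omega(x),D^{\sigma-1}\omega(x)\big),\quad x>0,\qquad \omega(0)=0,\quad D^{\sigma-1}\omega(x)|_{x=0}=b,$$ has at most one solution in $C^{\sigma-1}([0,T_0])$.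
   Context: For $1<\sigma<2$, the Riemann-Liouville derivatives (lower terminal $0$) are $$D^{\sigma}\omega(x)=\frac{1}{\Gamma(2-\sigma)}\frac{d^2}{dx^2}\int_0^x\frac{\omega(t)}{(x-t)^{\sigma-1}}dt,\qquad D^{\sigma-1}\omega(x)=\frac{1}{\Gamma(2-\sigma)}\frac{d}{dx}\int_0^x\frac{\omega(t)}{(x-t)^{\sigma-1}}dt.$$ For $0<\beta<1$ and $a>0$, $C^{\beta}([0,a])$ is the space of continuous functions on $[0,a]$ whose Riemann-Liouville derivative $D^{\beta}\omega$ is continuous on $[0,a]$, with norm $\|\omega\|_\infty+\|D^\beta\omega\|_\infty$. A solution in $C^{\sigma-1}([0,a])$ of the initial value problem is a function $\omega\in C^{\sigma-1}([0,a])$ satisfying the differential equation for $0<x\le a$ and both initial conditions. At $x=0$, expressions $x^{\sigma-1}f(x,\cdot,\cdot)$ are understood via the continuous extension. Existence time $T_0$: let $r,\mathcal{M}>0$ be such that $|x^{\sigma-1}f(x,w,v)|\le\mathcal{M}$ for all $(x,w,v)\in[0,T]\times[-r_1,r_1]\times[b-r_2,b+r_2]$, for all $r_1,r_2\ge0$ with $r_1+r_2\le r$. Put $C(b,\sigma,\mathcal{M})=\frac{|b|}{\Gamma(\sigma)}+\mathcal{M}\frac{1+\Gamma(3-\sigma)}{2-\sigma}$ and $\rho=r/C(b,\sigma,\mathcal{M})$. Then $T_0=\min\{T,\rho^{1/\alpha}\}$, where $\alpha=1$ if $\rho\ge1$; $\alpha=\sigma-1$ if $\rho<1$ and $1<\sigma\le3/2$;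 $\alpha=2-\sigma$ if $\rho<1$ and $3/2\le\sigma<2$. *)

theory Defs
  imports "HOL-Analysis.Analysis"
begin

definition RL_kernel_integral :: "real \<Rightarrow> (real \<Rightarrow> real) \<Rightarrow> real \<Rightarrow> real" where
  "RL_kernel_integral \<beta> w x = integral {0..x} (\<lambda>t. w t / (x - t) powr \<beta>)"

text \<open>Functions on $[0,a]$ are represented by total functions on the reals of which only the
  values on $[0,a]$ matter. All derivatives are therefore taken within $[0,a]$: they are one-sided
  at the two end points. The operators below are meaningful only where the derivatives exist;
  existence is demanded in the definitions of the space and of a solution.\<close>

text \<open>$D^\beta$ for $0 < \beta < 1$; with $\beta = \sigma - 1$ the factor is $1/\Gamma(2-\sigma)$.\<close>

definition RL_deriv :: "real \<Rightarrow> real \<Rightarrow> (real \<Rightarrow> real) \<Rightarrow> real \<Rightarrow> real" where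
  "RL_deriv \<beta> a w x =
     1 / Gamma (1 - \<beta>) * vector_derivative (RL_kernel_integral \<beta> w) (at x within {0..a})"

text \<open>$D^\sigma$ for $1 < \sigma < 2$.\<close>

definition RL_deriv2 :: "real \<Rightarrow> real \<Rightarrow> (real \<Rightarrow> real) \<Rightarrow> real \<Rightarrow> real" where
  "RL_deriv2 \<sigma> a w x =
     1 / Gamma (2 - \<sigma>) *
     vector_derivative
       (\<lambda>y. vector_derivative (RL_kernel_integral (\<sigma> - 1) w) (at y within {0..a}))
       (at x within {0..a})"

text \<open>The space $C^\beta([0,a])$. At $0$, continuity of $D^\beta w$ refers to the one-sided
  derivative. This agrees with asking that $D^\beta w$ on $(0,a]$ extend continuously to $0$,
  because the kernel integral of a continuous function is continuous on $[0,a]$.\<close>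

definition RL_space :: "real \<Rightarrow> real \<Rightarrow> (real \<Rightarrow> real) set" where
  "RL_space \<beta> a =
     {w. continuous_on {0..a} w \<and>
         RL_kernel_integral \<beta> w differentiable_on {0..a} \<and>
         continuous_on {0..a} (RL_deriv \<beta> a w)}"

definition is_IVP_solution ::
  "real \<Rightarrow> (real \<Rightarrow> real \<Rightarrow> real \<Rightarrow> real) \<Rightarrow> real \<Rightarrow> real \<Rightarrow> (real \<Rightarrow> real) \<Rightarrow> bool" where
  "is_IVP_solution \<sigma> f b a w \<longleftrightarrow>
     w \<in> RL_space (\<sigma> - 1) a \<and>
     (\<forall>x\<in>{0<..a}.
        (\<lambda>y. vector_derivative (RL_kernel_integral (\<sigma> - 1) w) (at y within {0..a}))
          differentiable (at x within {0..a}) \<and>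
        RL_deriv2 \<sigma> a w x = f x (w x) (RL_deriv (\<sigma> - 1) a w x)) \<and>
     w 0 = 0 \<and>
     RL_deriv (\<sigma> - 1) a w 0 = b"

definition C_const :: "real \<Rightarrow> real \<Rightarrow> real \<Rightarrow> real" where
  "C_const b \<sigma> M = \<bar>b\<bar> / Gamma \<sigma> + M * ((1 + Gamma (3 - \<sigma>)) / (2 - \<sigma>))"

definition rho :: "real \<Rightarrow> real \<Rightarrow> real \<Rightarrow> real \<Rightarrow> real" where
  "rho b \<sigma> r M = r / C_const b \<sigma> M"

definition time_exponent :: "real \<Rightarrow> real \<Rightarrow> real" where
  "time_exponent \<sigma> \<rho> = (if \<rho> \<ge> 1 then 1 else if \<sigma> \<le> 3 / 2 then \<sigma> - 1 else 2 - \<sigma>)"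

definition existence_time :: "real \<Rightarrow> real \<Rightarrow> real \<Rightarrow> real \<Rightarrow> real \<Rightarrow> real" where
  "existence_time \<sigma> b T r M =
     min T (rho b \<sigma> r M powr (1 / time_exponent \<sigma> (rho b \<sigma> r M)))"

end

theory Submission
  imports Defs
begin

text \<open>Let \<open>u\<close> be the difference of two solutions and \<open>d\<close> the derivative of its kernel integral, so
  that \<open>d\<close> is a multiple of \<open>D\<^sup>\<beta> u\<close> with \<open>\<beta> = \<sigma> - 1\<close>. Abel's inversion (Fubini on a triangle)
  and an integration by parts express the antiderivative of \<open>u\<close> through the integral of
  \<open>d t * (x - t) powr \<beta>\<close>, and since this depends on \<open>x\<close> in a Lipschitz way, \<open>\<bar>u x\<bar>\<close> is at most a
  constant times the supremum of \<open>\<bar>d\<bar>\<close> on \<open>[0, x]\<close>. The equation and the Lipschitz condition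
  then bound \<open>\<bar>d' x\<bar>\<close> by \<open>A * x powr (-\<beta>)\<close> times the same supremum. As the singularity
  \<open>x powr (-\<beta>)\<close> is integrable and \<open>d 0 = 0\<close>, a Gronwall argument gives \<open>d = 0\<close>, hence \<open>u = 0\<close>.\<close>

section \<open>Integrals of power kernels\<close>

text \<open>The kernel integrals are evaluated as gauge integrals, whereas domination and Fubini
  need Lebesgue integrals. For nonnegative measurable integrands the value carries over.\<close>

lemma has_bochner_integral_indicator_lborel:
  fixes f :: "real \<Rightarrow> real"
  assumes "f \<in> borel_measurable borel" "S \<in> sets borel" "\<And>x. x \<in> S \<Longrightarrow> 0 \<le> f x"
    and "(f has_integral I) S"
  shows "has_bochner_integral lborel (\<lambda>x. indicator S x * f x) I"
proof (rule has_bochner_integral_nn_integral)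
  have I: "((\<lambda>x. indicator S x * f x) has_integral I) UNIV"
    using assms(4) unfolding has_integral_restrict_UNIV[of S f, symmetric]
    by (rule has_integral_eq[rotated]) (auto simp: indicator_def)
  show "(\<integral>\<^sup>+x. indicator S x * f x \<partial>lborel) = ennreal I"
    using assms I by (intro nn_integral_has_integral_lborel) (auto simp: indicator_def)
  show "0 \<le> I"
    using assms(3,4) has_integral_nonneg by blast
qed (use assms in \<open>auto simp: indicator_def\<close>)

text \<open>For \<open>p < 0\<close> the integrand is unbounded near \<open>t = x\<close>, but the
  antiderivative stays continuous there because \<open>p + 1 > 0\<close>; differentiability in the
  interior then suffices.\<close>

lemma has_integral_powr_diff:
  fixes p x y :: real
  assumes "-1 < p" "y \<le> x"
  shows "((\<lambda>t. (x - t) powr p) has_integral (x - y) powr (p + 1) / (p + 1)) {y..x}"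
proof -
  have "((\<lambda>t. (x - t) powr p) has_integral
      (- 1 / (p + 1) * (x - x) powr (p + 1) - - 1 / (p + 1) * (x - y) powr (p + 1))) {y..x}"
  proof (rule fundamental_theorem_of_calculus_interior[OF assms(2)])
    show "continuous_on {y..x} (\<lambda>t. - 1 / (p + 1) * (x - t) powr (p + 1))"
      using assms by (intro continuous_intros continuous_on_powr') auto
    show "((\<lambda>t. - 1 / (p + 1) * (x - t) powr (p + 1)) has_vector_derivative (x - t) powr p) (at t)"
      if "t \<in> {y<..<x}" for t
      unfolding has_real_derivative_iff_has_vector_derivative[symmetric]
      using that assms by (auto intro!: derivative_eq_intros)
  qed
  then show ?thesis by simp
qed

text \<open>An affine substitution in Euler's integral. The powers of \<open>x - s\<close> cancel,
  since -\<beta>, \<beta> - 1 and the 1 from the change of variable sum to 0. That the value depends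
  on neither \<open>s\<close> nor \<open>x\<close> is what makes Abel's inversion work.\<close>

lemma has_integral_Beta_interval:
  fixes \<beta> s x :: real
  assumes "0 < \<beta>" "\<beta> < 1" "s < x"
  shows "((\<lambda>t. (t - s) powr (-\<beta>) * (x - t) powr (\<beta> - 1)) has_integral Beta (1 - \<beta>) \<beta>) {s..x}"
proof -
  let ?d = "x - s"
  have "((\<lambda>t. t powr (1 - \<beta> - 1) * (1 - t) powr (\<beta> - 1)) has_integral Beta (1 - \<beta>) \<beta>) (cbox 0 1)"
    using has_integral_Beta_real[of "1 - \<beta>" \<beta>] assms by simp
  from has_integral_affinity'[OF this, of "1 / ?d" "- s / ?d"] assms
  have "((\<lambda>t. (t / ?d - s / ?d) powr (-\<beta>) * (1 - (t / ?d - s / ?d)) powr (\<beta> - 1))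
      has_integral ?d * Beta (1 - \<beta>) \<beta>) {(0 - - s / ?d) / (1 / ?d)..(1 - - s / ?d) / (1 / ?d)}"
    by (simp add: mult.commute)
  moreover have "(0 - - s / ?d) / (1 / ?d) = s" "(1 - - s / ?d) / (1 / ?d) = x"
    using assms by (simp_all add: field_simps)
  ultimately have "((\<lambda>t. (t / ?d - s / ?d) powr (-\<beta>) * (1 - (t / ?d - s / ?d)) powr (\<beta> - 1))
      has_integral ?d * Beta (1 - \<beta>) \<beta>) {s..x}"
    by (simp only:)
  from has_integral_mult_right[OF this, of "1 / ?d"] assms
  have "((\<lambda>t. 1 / ?d * ((t / ?d - s / ?d) powr (-\<beta>) * (1 - (t / ?d - s / ?d)) powr (\<beta> - 1)))
      has_integral Beta (1 - \<beta>) \<beta>) {s..x}"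
    by simp
  then show ?thesis
  proof (rule has_integral_eq[rotated])
    fix t assume t: "t \<in> {s..x}"
    have "t / ?d - s / ?d = (t - s) / ?d"
      by (rule diff_divide_distrib[symmetric])
    moreover have "1 - (t - s) / ?d = (?d - (t - s)) / ?d"
      unfolding diff_divide_distrib[of ?d "t - s" ?d] using assms by simp
    moreover have "?d powr (-\<beta>) * ?d powr (\<beta> - 1) = 1 / ?d"
      using assms powr_add[of ?d "-\<beta>" "\<beta> - 1"] powr_minus_divide[of ?d 1] by simp
    ultimately show "1 / ?d * ((t / ?d - s / ?d) powr (-\<beta>) * (1 - (t / ?d - s / ?d)) powr (\<beta> - 1))
        = (t - s) powr (-\<beta>) * (x - t) powr (\<beta> - 1)"
      using t assms by (simp add: powr_divide)
  qed
qed

lemma continuous_mult_powr_integrable: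
  fixes u :: "real \<Rightarrow> real"
  assumes "-1 < p" "0 \<le> x" "continuous_on {0..x} u"
  shows "integrable lborel (\<lambda>t. indicator {0..x} t * u t * (x - t) powr p)"
proof -
  obtain C where C: "\<And>t. t \<in> {0..x} \<Longrightarrow> \<bar>u t\<bar> \<le> C"
    using compact_imp_bounded[OF compact_continuous_image[OF assms(3) compact_Icc]]
    unfolding bounded_iff by force
  have [measurable]: "(\<lambda>t. indicator {0..x} t * u t) \<in> borel_measurable borel"
    using borel_measurable_continuous_on_indicator[OF _ assms(3)] by simp
  have "has_bochner_integral lborel (\<lambda>t. indicator {0..x} t * (x - t) powr p) (x powr (p + 1) / (p + 1))"
    using has_integral_powr_diff[OF assms(1,2)]
    by (intro has_bochner_integral_indicator_lborel) auto
  then have "integrable lborel (\<lambda>t. C * (indicator {0..x} t * (x - t) powr p))"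
    by (auto simp: has_bochner_integral_iff)
  then show ?thesis
  proof (rule Bochner_Integration.integrable_bound)
    show "AE t in lborel. norm (indicator {0..x} t * u t * (x - t) powr p)
        \<le> norm (C * (indicator {0..x} t * (x - t) powr p))"
      using C by (intro AE_I2) (force simp: indicator_def abs_mult intro: mult_right_mono)
  qed simp
qed

lemma continuous_mult_powr_has_integral:
  fixes u :: "real \<Rightarrow> real"
  assumes "-1 < p" "0 \<le> x" "continuous_on {0..x} u"
  shows "((\<lambda>t. u t * (x - t) powr p) has_integral
    (\<integral>t. indicator {0..x} t * u t * (x - t) powr p \<partial>lborel)) {0..x}"
  unfolding has_integral_restrict_UNIV[of "{0..x}", symmetric]
  using has_integral_integral_lborel[OF continuous_mult_powr_integrable[OF assms]]
  by (rule has_integral_eq[rotated]) (auto simp: indicator_def)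

section \<open>Abel's inversion\<close>

lemma RL_kernel_integral_powr:
  "RL_kernel_integral \<beta> w x = integral {0..x} (\<lambda>t. w t * (x - t) powr (-\<beta>))"
  \<comment> \<open>At \<open>t = x\<close> both integrands are 0, by \<open>0 powr _ = 0\<close>
    and division by zero.\<close>
  unfolding RL_kernel_integral_def by (simp add: powr_minus_divide)

text \<open>The left side is a double integral over the triangle
  \<open>0 \<le> s \<le> t \<le> x\<close>. With the order exchanged, the integral over
  \<open>t\<close> is the constant \<open>Beta (1 - \<beta>) \<beta>\<close>, and only the integral
  of \<open>u\<close> remains.\<close>

lemma Abel_integral:
  fixes u :: "real \<Rightarrow> real"
  assumes \<beta>: "0 < \<beta>" "\<beta> < 1" and x: "0 \<le> x" and u: "continuous_on {0..x} u"
  shows "((\<lambda>t. RL_kernel_integral \<beta> u t * (x - t) powr (\<beta> - 1))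
    has_integral Beta (1 - \<beta>) \<beta> * integral {0..x} u) {0..x}"
proof -
  define B where "B = Beta (1 - \<beta>) \<beta>"
  define U where "U = (\<lambda>t. indicator {0..x} t * u t)"
  have U_meas [measurable]: "U \<in> borel_measurable borel"
    using borel_measurable_continuous_on_indicator[OF _ u] unfolding U_def by simp
  have U_int: "integrable lborel U"
    using borel_integrable_compact[OF compact_Icc u] unfolding U_def by simp
  define h where "h = (\<lambda>s t. U s * (if s \<le> t \<and> t \<le> x then (t - s) powr (-\<beta>) * (x - t) powr (\<beta> - 1) else 0))"
  have h_meas: "(\<lambda>(s, t). h s t) \<in> borel_measurable (lborel \<Otimes>\<^sub>M lborel)"
    unfolding h_def by measurable
  have K: "has_bochner_integral lborel
      (\<lambda>t. if s \<le> t \<and> t \<le> x then (t - s) powr (-\<beta>) * (x - t) powr (\<beta> - 1) else 0) B" if "s < x" for s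
    using has_bochner_integral_indicator_lborel[OF _ _ _ has_integral_Beta_interval[OF \<beta> that]]
    unfolding B_def
    by (rule has_bochner_integral_cong[THEN iffD1, rotated -1]) (auto simp: indicator_def)
  \<comment> \<open>At \<open>s = x\<close> the slice of the triangle is a single point, so its
    integral is 0 and not \<open>B * U x\<close>; this null set is excluded. For
    \<open>s > x\<close> both sides vanish with \<open>U\<close>.\<close>
  have ne: "AE s in lborel. s \<noteq> x"
    by (rule AE_lborel_singleton)
  have hs: "has_bochner_integral lborel (h s) (B * U s)" if "s \<noteq> x" for s
  proof (cases "s < x")
    case True
    then show ?thesis
      unfolding h_def mult.commute[of B] by (intro has_bochner_integral_mult_right K)
  next
    case False
    then show ?thesis using that unfolding h_def U_def by (simp add: has_bochner_integral_zero)
  qed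
  have h_abs: "has_bochner_integral lborel (\<lambda>t. norm (h s t)) (B * \<bar>U s\<bar>)" if "s \<noteq> x" for s
  proof (cases "s < x")
    case True
    have "(\<lambda>t. norm (h s t)) = (\<lambda>t. \<bar>U s\<bar> * (if s \<le> t \<and> t \<le> x then (t - s) powr (-\<beta>) * (x - t) powr (\<beta> - 1) else 0))"
      unfolding h_def by (auto simp: abs_mult)
    then show ?thesis
      unfolding mult.commute[of B] using has_bochner_integral_mult_right[OF K[OF True], of "\<bar>U s\<bar>"] by simp
  next
    case False
    then show ?thesis using that unfolding h_def U_def by (simp add: has_bochner_integral_zero)
  qed
  have int: "integrable (lborel \<Otimes>\<^sub>M lborel) (\<lambda>(s, t). h s t)"
  proof (rule lborel_pair.Fubini_integrable[OF h_meas])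
    \<comment> \<open>The kernel is nonnegative, so taking norms inside the integral over
      \<open>t\<close> only replaces \<open>U s\<close> by its absolute value.\<close>
    have "integrable lborel (\<lambda>s. B * \<bar>U s\<bar>)"
      using U_int by auto
    then show "integrable lborel (\<lambda>s. \<integral>t. norm (case (s, t) of (s, t) \<Rightarrow> h s t) \<partial>lborel)"
    proof (rule integrable_cong_AE_imp)
      show "AE s in lborel. B * \<bar>U s\<bar> = (\<integral>t. norm (case (s, t) of (s, t) \<Rightarrow> h s t) \<partial>lborel)"
        using ne h_abs by (auto simp: has_bochner_integral_iff elim!: eventually_mono)
    qed (use h_meas in measurable)
    show "AE s in lborel. integrable lborel (\<lambda>t. case (s, t) of (s, t) \<Rightarrow> h s t)"
      using ne hs by (auto simp: has_bochner_integral_iff elim!: eventually_mono)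
  qed
  have inner: "(\<integral>s. h s t \<partial>lborel) = (if t \<in> {0..x} then RL_kernel_integral \<beta> u t * (x - t) powr (\<beta> - 1) else 0)" for t
  proof (cases "t \<in> {0..x}")
    case True
    have "(\<integral>s. h s t \<partial>lborel) = (\<integral>s. indicator {0..t} s * u s * (t - s) powr (-\<beta>) * (x - t) powr (\<beta> - 1) \<partial>lborel)"
      using True by (intro Bochner_Integration.integral_cong) (auto simp: h_def U_def indicator_def)
    also have "\<dots> = (\<integral>s. indicator {0..t} s * u s * (t - s) powr (-\<beta>) \<partial>lborel) * (x - t) powr (\<beta> - 1)"
      by simp
    also have "(\<integral>s. indicator {0..t} s * u s * (t - s) powr (-\<beta>) \<partial>lborel) = RL_kernel_integral \<beta> u t"
      unfolding RL_kernel_integral_powr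
      using True \<beta> by (intro integral_unique[symmetric] continuous_mult_powr_has_integral continuous_on_subset[OF u]) auto
    finally show ?thesis using True by simp
  next
    case False
    then have "h s t = 0" for s
      by (auto simp: h_def U_def indicator_def)
    with False show ?thesis by auto
  qed
  have "(\<integral>t. (\<integral>s. h s t \<partial>lborel) \<partial>lborel) = (\<integral>s. (\<integral>t. h s t \<partial>lborel) \<partial>lborel)"
    by (rule lborel_pair.Fubini_integral[OF int])
  also have "\<dots> = (\<integral>s. B * U s \<partial>lborel)"
    using h_meas ne hs by (intro integral_cong_AE) (auto simp: has_bochner_integral_iff elim!: eventually_mono)
  also have "\<dots> = B * integral {0..x} u"
  proof -
    have "integral\<^sup>L lborel U = integral UNIV U"
      using integral_lborel[OF U_int] by simp
    also have "\<dots> = integral {0..x} u"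
      unfolding integral_restrict_UNIV[of "{0..x}" u, symmetric]
      by (intro arg_cong[of _ _ "integral UNIV"]) (auto simp: U_def indicator_def)
    finally show ?thesis by simp
  qed
  finally have "((\<lambda>t. \<integral>s. h s t \<partial>lborel) has_integral B * integral {0..x} u) UNIV"
    using has_integral_integral_lborel[OF lborel_pair.integrable_snd[OF int]] by simp
  then show ?thesis
    unfolding inner has_integral_restrict_UNIV B_def .
qed

section \<open>A Gronwall argument with an integrable singularity\<close>

text \<open>\<open>B\<close> ranges over all bounds of \<open>\<bar>v\<bar>\<close> on
  \<open>[0, x]\<close>, so no supremum has to be formed. A weight \<open>E\<close> whose logarithm
  is a multiple of the integral of \<open>t powr (-\<beta>)\<close> absorbs the singularity, and the
  maximum \<open>N\<close> of \<open>\<bar>v\<bar> / E\<close> satisfies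
  \<open>N \<le> N / 2\<close>.\<close>

lemma Gronwall_weakly_singular:
  fixes v v' :: "real \<Rightarrow> real"
  assumes "\<beta> < 1" "0 < A"
    and cont: "continuous_on {0..a} v" and "v 0 = 0"
    and deriv: "\<And>x. 0 < x \<Longrightarrow> x < a \<Longrightarrow> (v has_vector_derivative v' x) (at x)"
    and bound: "\<And>x B. 0 < x \<Longrightarrow> x < a \<Longrightarrow> (\<And>t. t \<in> {0..x} \<Longrightarrow> \<bar>v t\<bar> \<le> B) \<Longrightarrow> \<bar>v' x\<bar> \<le> A * x powr (-\<beta>) * B"
    and "x \<in> {0..a}"
  shows "v x = 0"
proof -
  \<comment> \<open>Chosen so that \<open>\<kappa> * (1 - \<beta>) = 2 * A\<close>: then
    \<open>N / 2 * E\<close> has exactly the derivative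
    \<open>A * t powr (-\<beta>) * (N * E t)\<close>.\<close>
  define \<kappa> where "\<kappa> = 2 * A / (1 - \<beta>)"
  have \<kappa>: "\<kappa> > 0" using assms unfolding \<kappa>_def by simp
  \<comment> \<open>The weight turns the bound on \<open>v'\<close> into a contraction with factor \<open>1/2\<close>, so no
    continuation over small intervals is needed.\<close>
  define E where "E = (\<lambda>t. exp (\<kappa> * t powr (1 - \<beta>)))"
  have E_cont: "continuous_on {0..y} E" for y
    unfolding E_def using assms(1) by (intro continuous_intros continuous_on_powr') auto
  have E_mono: "E s \<le> E t" if "0 \<le> s" "s \<le> t" for s t
    unfolding E_def using that \<kappa> assms(1) by (auto intro!: mult_left_mono powr_mono2)
  have "continuous_on {0..a} (\<lambda>t. \<bar>v t\<bar> / E t)"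
    using cont E_cont by (intro continuous_intros) (auto simp: E_def)
  then obtain z where z: "z \<in> {0..a}" and z_max: "\<And>t. t \<in> {0..a} \<Longrightarrow> \<bar>v t\<bar> / E t \<le> \<bar>v z\<bar> / E z"
    using continuous_attains_sup[of "{0..a}" "\<lambda>t. \<bar>v t\<bar> / E t"] assms(7) by auto
  define N where "N = \<bar>v z\<bar> / E z"
  have N0: "N \<ge> 0" unfolding N_def E_def by simp
  have vN: "\<bar>v t\<bar> \<le> N * E t" if "t \<in> {0..a}" for t
    using z_max[OF that] unfolding N_def[symmetric] by (simp add: E_def divide_le_eq)
  have "N \<le> N / 2"
  proof (cases "z = 0")
    case True
    then show ?thesis using \<open>v 0 = 0\<close> unfolding N_def by simp
  next
    case False
    then have z0: "0 < z" using z by simp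
    \<comment> \<open>Mean value inequality with majorant \<open>N / 2 * E\<close>: the estimate
      \<open>\<bar>v\<bar> \<le> N * E\<close> is fed back through \<open>bound\<close>.\<close>
    have "norm (v z - v 0) \<le> N / 2 * E z - N / 2 * E 0"
    proof (rule differentiable_bound_general[OF z0])
      show "continuous_on {0..z} v" using cont z by (auto intro: continuous_on_subset)
      show "continuous_on {0..z} (\<lambda>t. N / 2 * E t)" by (intro continuous_intros E_cont)
      fix t assume t: "0 < t" "t < z"
      then have ta: "t < a" using z by simp
      show "(v has_vector_derivative v' t) (at t)" using deriv t ta by simp
      show "((\<lambda>t. N / 2 * E t) has_vector_derivative A * t powr (-\<beta>) * (N * E t)) (at t)"
      proof -
        have "(E has_real_derivative E t * (\<kappa> * (1 - \<beta>) * t powr (-\<beta>))) (at t)"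
          unfolding E_def using t by (auto intro!: derivative_eq_intros)
        from DERIV_cmult[OF this, of "N / 2"] show ?thesis
          using assms(1)
          by (simp add: has_real_derivative_iff_has_vector_derivative[symmetric] \<kappa>_def mult_ac)
      qed
      \<comment> \<open>\<open>bound\<close> needs one constant on all of \<open>[0, t]\<close>;
        monotonicity of \<open>E\<close> supplies it.\<close>
      have "\<bar>v s\<bar> \<le> N * E t" if "s \<in> {0..t}" for s
        using vN[of s] mult_left_mono[OF E_mono[of s t] N0] that ta by simp
      then show "norm (v' t) \<le> A * t powr (-\<beta>) * (N * E t)"
        using bound[OF t(1) ta] by simp
    qed
    then have "\<bar>v z\<bar> \<le> N / 2 * E z"
      using \<open>v 0 = 0\<close> N0 by (simp add: E_def)
    then show ?thesis
      unfolding N_def by (simp add: E_def field_simps)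
  qed
  with N0 have "N = 0" by simp
  with vN[OF assms(7)] show ?thesis by simp
qed

section \<open>Bounding a function by its fractional derivative\<close>

text \<open>Integrate the singular factor and differentiate \<open>W\<close>. The boundary terms
  vanish, at \<open>t = 0\<close> by \<open>W 0 = 0\<close> and at \<open>t = x\<close> by
  \<open>0 powr \<beta> = 0\<close>.\<close>

lemma integral_by_parts_powr:
  fixes W d :: "real \<Rightarrow> real"
  assumes "0 < \<beta>" "0 \<le> x" "W 0 = 0" and d: "continuous_on {0..x} d"
    and W: "\<And>t. t \<in> {0..x} \<Longrightarrow> (W has_vector_derivative d t) (at t within {0..x})"
  shows "((\<lambda>t. W t * (x - t) powr (\<beta> - 1)) has_integral
    1 / \<beta> * integral {0..x} (\<lambda>t. d t * (x - t) powr \<beta>)) {0..x}"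
proof -
  have W_cont: "continuous_on {0..x} W"
    using W by (rule continuous_on_vector_derivative)
  have "((\<lambda>t. W t * (x - t) powr (\<beta> - 1) - 1 / \<beta> * (d t * (x - t) powr \<beta>)) has_integral
      (- (1 / \<beta>) * (W x * (x - x) powr \<beta>) - - (1 / \<beta>) * (W 0 * (x - 0) powr \<beta>))) {0..x}"
  proof (rule fundamental_theorem_of_calculus_interior[OF assms(2)])
    show "continuous_on {0..x} (\<lambda>t. - (1 / \<beta>) * (W t * (x - t) powr \<beta>))"
      using assms(1) by (intro continuous_intros W_cont continuous_on_powr') auto
    fix t assume t: "t \<in> {0<..<x}"
    then have "(W has_real_derivative d t) (at t)"
      using W[of t] at_within_Icc_at[of 0 t x]
      by (simp add: has_real_derivative_iff_has_vector_derivative)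
    moreover have "((\<lambda>t. (x - t) powr \<beta>) has_real_derivative - \<beta> * (x - t) powr (\<beta> - 1)) (at t)"
      using t by (auto intro!: derivative_eq_intros)
    ultimately have "((\<lambda>t. - (1 / \<beta>) * (W t * (x - t) powr \<beta>)) has_real_derivative
        - (1 / \<beta>) * (d t * (x - t) powr \<beta> + - \<beta> * (x - t) powr (\<beta> - 1) * W t)) (at t)"
      by (intro DERIV_cmult DERIV_mult)
    then show "((\<lambda>t. - (1 / \<beta>) * (W t * (x - t) powr \<beta>)) has_vector_derivative
        W t * (x - t) powr (\<beta> - 1) - 1 / \<beta> * (d t * (x - t) powr \<beta>)) (at t)"
      unfolding has_real_derivative_iff_has_vector_derivative[symmetric]
      using assms(1) by (simp add: algebra_simps)
  qed
  then have parts: "((\<lambda>t. W t * (x - t) powr (\<beta> - 1) - 1 / \<beta> * (d t * (x - t) powr \<beta>)) has_integral 0) {0..x}"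
    using assms(3) by simp
  have "(\<lambda>t. d t * (x - t) powr \<beta>) integrable_on {0..x}"
    using assms(1) by (intro integrable_continuous_real continuous_intros d continuous_on_powr') auto
  then have "((\<lambda>t. 1 / \<beta> * (d t * (x - t) powr \<beta>)) has_integral
      1 / \<beta> * integral {0..x} (\<lambda>t. d t * (x - t) powr \<beta>)) {0..x}"
    by (intro has_integral_mult_right integrable_integral)
  from has_integral_add[OF parts this] show ?thesis
    by simp
qed

lemma powr_Suc_diff_le:
  fixes \<beta> x y :: real
  assumes "0 < \<beta>" "0 \<le> y" "y \<le> x"
  shows "(x powr (\<beta> + 1) - y powr (\<beta> + 1)) / (\<beta> + 1) \<le> x powr \<beta> * (x - y)"
\<comment> \<open>The mean value theorem needs \<open>y < x\<close>, and the derivative of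
  \<open>powr\<close> is used at positive arguments only.\<close>
proof (cases "y = 0 \<or> y = x")
  case True
  then show ?thesis
    using assms by (auto simp: powr_add field_simps)
next
  case False
  then have y: "0 < y" "y < x" using assms by auto
  obtain z where z: "y < z" "z < x"
    "x powr (\<beta> + 1) - y powr (\<beta> + 1) = (x - y) * ((\<beta> + 1) * z powr \<beta>)"
    using MVT2[of y x "\<lambda>z. z powr (\<beta> + 1)" "\<lambda>z. (\<beta> + 1) * z powr \<beta>"] y
      has_real_derivative_powr[of _ "\<beta> + 1"] by auto
  have "z powr \<beta> \<le> x powr \<beta>"
    using z y assms by (intro powr_mono2) auto
  with z y assms show ?thesis
    by (simp add: mult.commute mult_left_mono)
qed

text \<open>For \<beta> < 1 the kernel itself is only Hoelder continuous in \<open>x\<close>, but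
  integration gains one order. As its increment \<open>k\<close> is nonnegative, the difference is
  at most \<open>B\<close> times the integral of \<open>k\<close>, which is elementary.\<close>

lemma powr_weighted_integral_Lipschitz:
  fixes d :: "real \<Rightarrow> real"
  assumes \<beta>: "0 < \<beta>" and xy: "0 \<le> y" "y \<le> x" and d: "continuous_on {0..x} d"
    and B: "\<And>t. t \<in> {0..x} \<Longrightarrow> \<bar>d t\<bar> \<le> B"
  shows "\<bar>integral {0..x} (\<lambda>t. d t * (x - t) powr \<beta>) - integral {0..y} (\<lambda>t. d t * (y - t) powr \<beta>)\<bar>
    \<le> B * (x powr \<beta> * (x - y))"
proof -
  \<comment> \<open>Cutting off at \<open>y\<close> by \<open>0 powr \<beta> = 0\<close> puts both integrals on the interval \<open>[0, x]\<close>.\<close>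
  define k where "k = (\<lambda>t. (x - t) powr \<beta> - (max 0 (y - t)) powr \<beta>)"
  have k0: "k t \<ge> 0" if "t \<in> {0..x}" for t
    unfolding k_def using that xy \<beta> by (auto intro!: powr_mono2)
  \<comment> \<open>Used twice: \<open>c = d\<close> gives the difference to be estimated, the
    constant \<open>B\<close> gives the value of its majorant.\<close>
  have split: "((\<lambda>t. c t * (x - t) powr \<beta> - c t * (max 0 (y - t)) powr \<beta>) has_integral
      integral {0..x} (\<lambda>t. c t * (x - t) powr \<beta>) - integral {0..y} (\<lambda>t. c t * (y - t) powr \<beta>)) {0..x}"
    if c: "continuous_on {0..x} c" for c
  proof (rule has_integral_diff)
    show "((\<lambda>t. c t * (x - t) powr \<beta>) has_integral integral {0..x} (\<lambda>t. c t * (x - t) powr \<beta>)) {0..x}"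
      using \<beta> by (intro integrable_integral integrable_continuous_real continuous_intros c continuous_on_powr') auto
    have "((\<lambda>t. c t * (y - t) powr \<beta>) has_integral integral {0..y} (\<lambda>t. c t * (y - t) powr \<beta>)) {0..y}"
      using \<beta> xy by (intro integrable_integral integrable_continuous_real continuous_intros
          continuous_on_subset[OF c] continuous_on_powr') auto
    then have "((\<lambda>t. c t * max 0 (y - t) powr \<beta>) has_integral integral {0..y} (\<lambda>t. c t * (y - t) powr \<beta>)) {0..y}"
      by (rule has_integral_eq[rotated]) auto
    moreover have "((\<lambda>t. c t * max 0 (y - t) powr \<beta>) has_integral 0) {y..x}"
      by (rule has_integral_is_0) auto
    ultimately have "((\<lambda>t. c t * max 0 (y - t) powr \<beta>) has_integral
        integral {0..y} (\<lambda>t. c t * (y - t) powr \<beta>) + 0) {0..x}"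
      by (rule has_integral_combine[OF xy])
    then show "((\<lambda>t. c t * max 0 (y - t) powr \<beta>) has_integral integral {0..y} (\<lambda>t. c t * (y - t) powr \<beta>)) {0..x}"
      by simp
  qed
  have dk: "((\<lambda>t. d t * k t) has_integral
      integral {0..x} (\<lambda>t. d t * (x - t) powr \<beta>) - integral {0..y} (\<lambda>t. d t * (y - t) powr \<beta>)) {0..x}"
    using split[OF d] by (simp add: k_def right_diff_distrib)
  have "integral {0..z} (\<lambda>t. B * (z - t) powr \<beta>) = B * (z powr (\<beta> + 1) / (\<beta> + 1))" if "0 \<le> z" for z
    using has_integral_powr_diff[of \<beta> 0 z] \<beta> that by (simp add: integral_unique)
  then have Bk: "((\<lambda>t. B * k t) has_integral B * ((x powr (\<beta> + 1) - y powr (\<beta> + 1)) / (\<beta> + 1))) {0..x}"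
    using split[of "\<lambda>_. B"] xy by (simp add: k_def right_diff_distrib diff_divide_distrib)
  have "norm (integral {0..x} (\<lambda>t. d t * k t)) \<le> integral {0..x} (\<lambda>t. B * k t)"
    using dk Bk B k0 by (intro integral_norm_bound_integral) (auto simp: abs_mult intro!: mult_right_mono)
  also have "\<dots> = B * ((x powr (\<beta> + 1) - y powr (\<beta> + 1)) / (\<beta> + 1))"
    using Bk by (rule integral_unique)
  also have "\<dots> \<le> B * (x powr \<beta> * (x - y))"
    using B[of 0] xy \<beta> by (intro mult_left_mono powr_Suc_diff_le) auto
  finally show ?thesis
    using integral_unique[OF dk] by simp
qed

text \<open>One-sided, because a bound for the fractional derivative on \<open>[0, x]\<close> only
  allows comparing \<open>x\<close> with smaller \<open>y\<close>. The bound on the difference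
  quotients passes to the limit.\<close>

lemma left_derivative_bound:
  fixes F :: "real \<Rightarrow> real"
  assumes "(F has_vector_derivative D) (at x within {a..x})" "a < x"
    and "\<And>y. y \<in> {a..x} \<Longrightarrow> \<bar>F x - F y\<bar> \<le> C * (x - y)"
  shows "\<bar>D\<bar> \<le> C"
proof (rule tendsto_upperbound)
  show "((\<lambda>y. \<bar>(F y - F x) / (y - x)\<bar>) \<longlongrightarrow> \<bar>D\<bar>) (at x within {a..x})"
    using assms(1) unfolding has_real_derivative_iff_has_vector_derivative[symmetric] has_field_derivative_iff
    by (rule tendsto_rabs)
  show "\<forall>\<^sub>F y in at x within {a..x}. \<bar>(F y - F x) / (y - x)\<bar> \<le> C"
    unfolding eventually_at_filter
  proof (intro always_eventually allI impI)
    fix y assume "y \<noteq> x" "y \<in> {a..x}"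
    then show "\<bar>(F y - F x) / (y - x)\<bar> \<le> C"
      using assms(3)[of y] by (simp add: abs_minus_commute divide_le_eq)
  qed
  show "at x within {a..x} \<noteq> bot"
    using assms(2) by (simp add: at_within_Icc_at_left)
qed

lemma bound_by_RL_derivative:
  fixes u :: "real \<Rightarrow> real"
  assumes \<beta>: "0 < \<beta>" "\<beta> < 1" and x: "0 < x" "x \<le> a" and u: "continuous_on {0..a} u"
    and W: "\<And>t. t \<in> {0..a} \<Longrightarrow> (RL_kernel_integral \<beta> u has_vector_derivative d t) (at t within {0..a})"
    and d: "continuous_on {0..a} d" and B: "\<And>t. t \<in> {0..x} \<Longrightarrow> \<bar>d t\<bar> \<le> B"
  shows "\<bar>u x\<bar> \<le> a powr \<beta> / (\<beta> * Beta (1 - \<beta>) \<beta>) * B"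
proof -
  let ?c = "Beta (1 - \<beta>) \<beta>"
  have c: "?c > 0"
    unfolding Beta_def using \<beta> by (auto intro!: divide_pos_pos mult_pos_pos)
  \<comment> \<open>One integral evaluated twice, by parts and by Abel's formula; division by
    \<open>?c\<close> isolates the antiderivative of \<open>u\<close>.\<close>
  have F: "integral {0..y} u = 1 / (\<beta> * ?c) * integral {0..y} (\<lambda>t. d t * (y - t) powr \<beta>)" if y: "y \<in> {0..x}" for y
  proof -
    have "((\<lambda>t. RL_kernel_integral \<beta> u t * (y - t) powr (\<beta> - 1)) has_integral
        1 / \<beta> * integral {0..y} (\<lambda>t. d t * (y - t) powr \<beta>)) {0..y}"
      using \<beta> x y
      by (intro integral_by_parts_powr continuous_on_subset[OF d] has_vector_derivative_within_subset[OF W])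
        (auto simp: RL_kernel_integral_def)
    moreover have "((\<lambda>t. RL_kernel_integral \<beta> u t * (y - t) powr (\<beta> - 1)) has_integral
        ?c * integral {0..y} u) {0..y}"
      using \<beta> x y by (intro Abel_integral continuous_on_subset[OF u]) auto
    ultimately have "1 / \<beta> * integral {0..y} (\<lambda>t. d t * (y - t) powr \<beta>) = ?c * integral {0..y} u"
      by (rule has_integral_unique)
    with c \<beta> show ?thesis by (simp add: field_simps)
  qed
  have "\<bar>u x\<bar> \<le> 1 / (\<beta> * ?c) * (B * x powr \<beta>)"
  \<comment> \<open>\<open>u x\<close> is the left derivative of the antiderivative of
    \<open>u\<close>, and \<open>F\<close> transfers the Lipschitz estimate to that
    antiderivative.\<close>
  proof (rule left_derivative_bound)
    show "((\<lambda>y. integral {0..y} u) has_vector_derivative u x) (at x within {0..x})"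
      using x by (intro integral_has_vector_derivative continuous_on_subset[OF u]) auto
    fix y assume y: "y \<in> {0..x}"
    have "\<bar>integral {0..x} (\<lambda>t. d t * (x - t) powr \<beta>) - integral {0..y} (\<lambda>t. d t * (y - t) powr \<beta>)\<bar>
        \<le> B * (x powr \<beta> * (x - y))"
      using \<beta> x y by (intro powr_weighted_integral_Lipschitz B continuous_on_subset[OF d]) auto
    from mult_left_mono[OF this, of "1 / (\<beta> * ?c)"] y x c \<beta>
    show "\<bar>integral {0..x} u - integral {0..y} u\<bar> \<le> 1 / (\<beta> * ?c) * (B * x powr \<beta>) * (x - y)"
      by (simp add: F abs_mult right_diff_distrib[symmetric] diff_divide_distrib[symmetric] mult.assoc)
  qed (use x in auto)
  \<comment> \<open>Replacing \<open>x\<close> by \<open>a\<close> makes the constant uniform on the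
    interval; \<open>B[of 0]\<close> yields \<open>B \<ge> 0\<close>.\<close>
  also have "\<dots> \<le> 1 / (\<beta> * ?c) * (B * a powr \<beta>)"
    using B[of 0] x \<beta> c by (intro mult_left_mono powr_mono2) auto
  finally show ?thesis by (simp add: mult.commute)
qed

section \<open>Uniqueness for the initial value problem\<close>

lemma RL_kernel_integral_diff:
  assumes "\<beta> < 1" "x \<in> {0..a}" "continuous_on {0..a} w1" "continuous_on {0..a} w2"
  shows "RL_kernel_integral \<beta> (\<lambda>t. w1 t - w2 t) x = RL_kernel_integral \<beta> w1 x - RL_kernel_integral \<beta> w2 x"
proof -
  have "(\<lambda>t. w t * (x - t) powr (-\<beta>)) integrable_on {0..x}" if "continuous_on {0..a} w" for w
    using assms(1,2) continuous_on_subset[OF that, of "{0..x}"]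
    by (intro has_integral_integrable[OF continuous_mult_powr_has_integral]) auto
  with assms(3,4) show ?thesis
    unfolding RL_kernel_integral_powr by (simp add: left_diff_distrib integral_diff)
qed

theorem theorem3p2:
  fixes \<sigma> T b r M L T0 :: real
    and f g :: "real \<Rightarrow> real \<Rightarrow> real \<Rightarrow> real"
  assumes "1 < \<sigma>" "\<sigma> < 2" "0 < T" "b \<noteq> 0"
    and f_cont: "continuous_on ({0<..T} \<times> UNIV \<times> UNIV) (\<lambda>(x, t1, t2). f x t1 t2)"
    \<comment> \<open>g is the continuous extension of x powr (\<sigma> - 1) * f x t1 t2 to x = 0\<close>
    and g_cont: "continuous_on ({0..T} \<times> UNIV \<times> UNIV) (\<lambda>(x, t1, t2). g x t1 t2)"
    and g_eq: "\<And>x t1 t2. x \<in> {0<..T} \<Longrightarrow> g x t1 t2 = x powr (\<sigma> - 1) * f x t1 t2"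
    and "0 < r" "0 < M"
    and bound: "\<And>r1 r2 x w v. r1 \<ge> 0 \<Longrightarrow> r2 \<ge> 0 \<Longrightarrow> r1 + r2 \<le> r \<Longrightarrow>
      x \<in> {0..T} \<Longrightarrow> w \<in> {-r1..r1} \<Longrightarrow> v \<in> {b - r2..b + r2} \<Longrightarrow> \<bar>g x w v\<bar> \<le> M"
    and T0: "T0 = existence_time \<sigma> b T r M"
    and "0 < L" "L \<le> (2 - \<sigma>) / (T * (1 + Gamma (3 - \<sigma>)))"
    and lipschitz: "\<And>x t11 t21 t12 t22. x \<in> {0..T} \<Longrightarrow>
      \<bar>g x t11 t21 - g x t12 t22\<bar> \<le> L * (\<bar>t11 - t12\<bar> + \<bar>t21 - t22\<bar>)"
  shows "\<forall>w1 w2. is_IVP_solution \<sigma> f b T0 w1 \<longrightarrow> is_IVP_solution \<sigma> f b T0 w2 \<longrightarrow>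
           (\<forall>x\<in>{0..T0}. w1 x = w2 x)"
proof (intro allI impI ballI)
  fix w1 w2 x
  assume sol: "is_IVP_solution \<sigma> f b T0 w1" "is_IVP_solution \<sigma> f b T0 w2" and x: "x \<in> {0..T0}"
  define \<beta> where "\<beta> = \<sigma> - 1"
  have \<beta>: "0 < \<beta>" "\<beta> < 1" using assms(1,2) by (auto simp: \<beta>_def)
  have \<sigma>_eq: "2 - \<sigma> = 1 - \<beta>" by (simp add: \<beta>_def)
  define \<gamma> where "\<gamma> = Gamma (1 - \<beta>)"
  have \<gamma>: "\<gamma> > 0" unfolding \<gamma>_def using \<beta> by simp
  have T0_le: "T0 \<le> T" unfolding T0 existence_time_def by simp
  \<comment> \<open>\<open>D\<close> and \<open>D2\<close> omit the Gamma factor: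
    \<open>D w / \<gamma>\<close> is \<open>RL_deriv\<close> and \<open>D2 w / \<gamma>\<close> is
    \<open>RL_deriv2\<close>.\<close>
  define D where "D = (\<lambda>w y. vector_derivative (RL_kernel_integral \<beta> w) (at y within {0..T0}))"
  define D2 where "D2 = (\<lambda>w y. vector_derivative (D w) (at y within {0..T0}))"
  have cont: "continuous_on {0..T0} w"
    and D: "\<And>t. t \<in> {0..T0} \<Longrightarrow> (RL_kernel_integral \<beta> w has_vector_derivative D w t) (at t within {0..T0})"
    and D_cont: "continuous_on {0..T0} (D w)"
    and D2: "\<And>t. 0 < t \<Longrightarrow> t < T0 \<Longrightarrow> (D w has_vector_derivative D2 w t) (at t)"
    and eq: "\<And>t. 0 < t \<Longrightarrow> t < T0 \<Longrightarrow> D2 w t = \<gamma> * f t (w t) (D w t / \<gamma>)"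
    and init: "w 0 = 0" "D w 0 = \<gamma> * b"
    if "is_IVP_solution \<sigma> f b T0 w" for w
  proof -
    have RL: "RL_deriv (\<sigma> - 1) T0 w t = D w t / \<gamma>" for t
      by (simp add: RL_deriv_def D_def \<beta>_def \<gamma>_def)
    have RL2: "RL_deriv2 \<sigma> T0 w t = D2 w t / \<gamma>" for t
      by (simp add: RL_deriv2_def D2_def D_def \<sigma>_eq \<gamma>_def \<beta>_def[symmetric])
    note sol = that[unfolded is_IVP_solution_def RL_space_def]
    show "continuous_on {0..T0} w" "w 0 = 0"
      using sol by auto
    show "D w 0 = \<gamma> * b"
      using sol \<gamma> unfolding RL by (simp add: field_simps)
    show "(RL_kernel_integral \<beta> w has_vector_derivative D w t) (at t within {0..T0})" if "t \<in> {0..T0}" for t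
      using sol that unfolding D_def vector_derivative_works[symmetric] differentiable_on_def \<beta>_def by auto
    have "continuous_on {0..T0} (\<lambda>t. \<gamma> * RL_deriv (\<sigma> - 1) T0 w t)"
      using sol by (intro continuous_intros) auto
    then show "continuous_on {0..T0} (D w)"
      using \<gamma> by (simp add: RL)
    \<comment> \<open>At interior points the derivative within \<open>{0..T0}\<close> is two-sided,
      as the Gronwall lemma requires.\<close>
    fix t assume t: "0 < t" "t < T0"
    have "(D w has_vector_derivative D2 w t) (at t within {0..T0})"
      using sol t unfolding D2_def vector_derivative_works[symmetric] D_def \<beta>_def by auto
    then show "(D w has_vector_derivative D2 w t) (at t)"
      using t by (simp add: at_within_Icc_at)
    show "D2 w t = \<gamma> * f t (w t) (D w t / \<gamma>)"
      using sol t \<gamma> unfolding RL RL2 by (auto simp: field_simps)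
  qed
  define u where "u = (\<lambda>t. w1 t - w2 t)"
  define d where "d = (\<lambda>t. D w1 t - D w2 t)"
  have u_cont: "continuous_on {0..T0} u" and d_cont: "continuous_on {0..T0} d"
    unfolding u_def d_def
    by (auto intro!: continuous_on_diff intro: cont[OF sol(1)] cont[OF sol(2)] D_cont[OF sol(1)] D_cont[OF sol(2)])
  have W: "(RL_kernel_integral \<beta> u has_vector_derivative d t) (at t within {0..T0})" if "t \<in> {0..T0}" for t
  proof (rule has_vector_derivative_transform[OF that])
    show "((\<lambda>t. RL_kernel_integral \<beta> w1 t - RL_kernel_integral \<beta> w2 t) has_vector_derivative d t)
        (at t within {0..T0})"
      unfolding d_def using sol that by (intro has_vector_derivative_diff D)
  qed (simp add: u_def RL_kernel_integral_diff[OF \<beta>(2) _ cont[OF sol(1)] cont[OF sol(2)]])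
  define K where "K = T0 powr \<beta> / (\<beta> * Beta (1 - \<beta>) \<beta>)"
  have u_bound: "\<bar>u t\<bar> \<le> K * B" if "0 < t" "t \<le> T0" "\<And>s. s \<in> {0..t} \<Longrightarrow> \<bar>d s\<bar> \<le> B" for t B
    unfolding K_def using that by (intro bound_by_RL_derivative[OF \<beta> _ _ u_cont W d_cont])
  have K: "K \<ge> 0"
    unfolding K_def Beta_def using \<beta> by (auto intro!: divide_nonneg_nonneg mult_nonneg_nonneg)
  have d0: "d t = 0" if "t \<in> {0..T0}" for t
  proof (rule Gronwall_weakly_singular[OF \<beta>(2) _ d_cont _ _ _ that])
    \<comment> \<open>After multiplication by \<open>\<gamma>\<close>, the bound on \<open>u\<close>
      contributes \<open>\<gamma> * K\<close> and the term \<open>d / \<gamma>\<close> contributes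
      \<open>1\<close>.\<close>
    show "0 < L * (\<gamma> * K + 1)"
      using \<open>0 < L\<close> \<gamma> K by (intro mult_pos_pos add_nonneg_pos) auto
    show "d 0 = 0"
      using init(2)[OF sol(1)] init(2)[OF sol(2)] by (simp add: d_def)
    fix t assume t: "0 < t" "t < T0"
    show "(d has_vector_derivative D2 w1 t - D2 w2 t) (at t)"
      unfolding d_def using sol t by (intro has_vector_derivative_diff D2)
    fix B assume B: "\<And>s. s \<in> {0..t} \<Longrightarrow> \<bar>d s\<bar> \<le> B"
    \<comment> \<open>The factor \<open>t powr \<beta>\<close> turns \<open>f\<close> into
      \<open>g\<close>, to which the Lipschitz condition applies.\<close>
    have "t powr \<beta> * (D2 w1 t - D2 w2 t) = \<gamma> * (g t (w1 t) (D w1 t / \<gamma>) - g t (w2 t) (D w2 t / \<gamma>))"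
      using t T0_le eq[OF sol(1) t] eq[OF sol(2) t] by (simp add: g_eq \<beta>_def algebra_simps)
    then have "t powr \<beta> * \<bar>D2 w1 t - D2 w2 t\<bar> = \<gamma> * \<bar>g t (w1 t) (D w1 t / \<gamma>) - g t (w2 t) (D w2 t / \<gamma>)\<bar>"
      using \<gamma> by (metis abs_mult abs_of_pos abs_of_nonneg powr_ge_zero)
    also have "\<dots> \<le> \<gamma> * (L * (\<bar>u t\<bar> + \<bar>d t / \<gamma>\<bar>))"
      using lipschitz[of t "w1 t" "D w1 t / \<gamma>" "w2 t" "D w2 t / \<gamma>"] t T0_le \<gamma>
      by (intro mult_left_mono) (auto simp: u_def d_def diff_divide_distrib)
    also have "\<dots> \<le> \<gamma> * (L * (K * B + B / \<gamma>))"
      using u_bound[of t B] B t \<gamma> \<open>0 < L\<close>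
      by (intro mult_left_mono add_mono) (auto simp: divide_right_mono)
    also have "\<dots> = L * (\<gamma> * K + 1) * B"
      using \<gamma> by (simp add: field_simps)
    finally show "\<bar>D2 w1 t - D2 w2 t\<bar> \<le> L * (\<gamma> * K + 1) * t powr (-\<beta>) * B"
      using t by (simp add: powr_minus field_simps)
  qed
  show "w1 x = w2 x"
  proof (cases "x = 0")
    case True
    then show ?thesis using init(1)[OF sol(1)] init(1)[OF sol(2)] by simp
  next
    case False
    \<comment> \<open>As \<open>d\<close> vanishes on \<open>{0..T0}\<close>, \<open>u_bound\<close>
      applies with the bound 0.\<close>
    then have "\<bar>u x\<bar> \<le> K * 0"
      using x d0 by (intro u_bound) auto
    then show ?thesis by (simp add: u_def)
  qed
qed

end
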